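(* Let $G$ be a graph with maximum degree at most $4$. Then $G$ admits a nowhere-zero $3$-flow if and only if $G$ admits an $S^1$-flow.
   Context: All graphs are finite and loopless; parallel edges are allowed. For an orientation $D$ of $G$ and $f:E(G)\to\mathbb{R}^d$, the boundary of $f$ at a vertex $v$ is $\partial_D f(v)=\sum_{e\in E_D^+(v)}f(e)-\sum_{e\in E_D^-(v)}f(e)$, where $E_D^+(v)$ and $E_D^-(v)$ are the sets of edges directed out of and into $v$. For $\Omega\subseteq\mathbb{R}^d$, an $\Omega$-flow of $G$ is a pair $(D,f)$ with $D$ an orientation of $G$, $f:E(G)\to\Omega$, and $\partial_D f(v)=\mathbf{0}$ for every $v\in V(G)$. A nowhere-zero $3$-flow is an $\Omega$-flow with $\Omega=\{\pm1,\pm2\}\subseteq\mathbb{R}$. An $S^1$-flow is an $\Omega$-flow with $\Omega=S^1=\{\mathbf{x}\in\mathbb{R}^2:\|\mathbf{x}\|=1\}$ (Euclidean norm). *)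

theory Defs
  imports "HOL-Analysis.Analysis" "Graph_Theory.Digraph"
begin

text \<open>
  Edges are named objects and \<open>ends\<close> sends an edge to its set of end vertices, so distinct
  edges may be parallel. Looplessness is the requirement that this set has two elements.
\<close>

record ('v, 'e) multigraph =
  vertices :: "'v set"
  edges :: "'e set"
  ends :: "'e \<Rightarrow> 'v set"

locale finite_loopless_graph =
  fixes G :: "('v, 'e) multigraph" (structure)
  assumes finite_vertices: "finite (vertices G)"
    and finite_edges: "finite (edges G)"
    and ends_in_vertices: "\<And>e. e \<in> edges G \<Longrightarrow> ends G e \<subseteq> vertices G"
    and card_ends: "\<And>e. e \<in> edges G \<Longrightarrow> card (ends G e) = 2"

definition degree :: "('v, 'e) multigraph \<Rightarrow> 'v \<Rightarrow> nat" where
  "degree G v = card {e \<in> edges G. v \<in> ends G e}"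

text \<open>For a finite graph the supremum below is a maximum; it is 0 if there are no vertices.\<close>

definition max_degree :: "('v, 'e) multigraph \<Rightarrow> nat" where
  "max_degree G = (SUP v\<in>vertices G. degree G v)"

text \<open>
  An orientation is a digraph with the same vertices, whose arcs are the edges themselves,
  each directed from one of its ends to the other.
\<close>

definition is_orientation :: "('v, 'e) pre_digraph \<Rightarrow> ('v, 'e) multigraph \<Rightarrow> bool" where
  "is_orientation D G \<longleftrightarrow> verts D = vertices G \<and> arcs D = edges G \<and>
     (\<forall>e\<in>edges G. {tail D e, head D e} = ends G e)"

definition boundary ::
    "('v, 'e) pre_digraph \<Rightarrow> ('e \<Rightarrow> 'b::euclidean_space) \<Rightarrow> 'v \<Rightarrow> 'b" where
  "boundary D f v = (\<Sum>e\<in>out_arcs D v. f e) - (\<Sum>e\<in>in_arcs D v. f e)"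

text \<open>The values of \<open>f\<close> outside the edge set are irrelevant.\<close>

definition is_flow :: "'b::euclidean_space set \<Rightarrow> ('v, 'e) multigraph \<Rightarrow>
    ('v, 'e) pre_digraph \<Rightarrow> ('e \<Rightarrow> 'b) \<Rightarrow> bool" where
  "is_flow \<Omega> G D f \<longleftrightarrow> is_orientation D G \<and> f ` edges G \<subseteq> \<Omega> \<and>
     (\<forall>v\<in>vertices G. boundary D f v = 0)"

definition admits_flow :: "'b::euclidean_space set \<Rightarrow> ('v, 'e) multigraph \<Rightarrow> bool" where
  "admits_flow \<Omega> G \<longleftrightarrow> (\<exists>D f. is_flow \<Omega> G D f)"

definition admits_nowhere_zero_3_flow :: "('v, 'e) multigraph \<Rightarrow> bool" where
  "admits_nowhere_zero_3_flow G \<longleftrightarrow> admits_flow {1, -1, 2, -2 :: real} G"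

definition admits_S1_flow :: "('v, 'e) multigraph \<Rightarrow> bool" where
  "admits_S1_flow G \<longleftrightarrow> admits_flow {x :: real ^ 2. norm x = 1} G"

end

theory Submission
  imports Defs
begin

text \<open>
  Both kinds of flow are compared with a third object: a function \<open>t\<close> on the
  edges with values \<open>1\<close> and \<open>-1\<close> whose boundary is divisible by \<open>3\<close> at every
  vertex (a modulo 3 orientation, relative to the given orientation). The tool
  that produces flows from it is integral rounding: a real function on the edges with
  integral boundary can be rounded edge by edge, up or down, without changing the
  boundary (\<open>integral_rounding\<close>).

  A unit vector flow from a nowhere-zero 3-flow \<open>h\<close>. Let \<open>t\<close> be the sign
  congruent to \<open>h\<close> modulo 3. Then \<open>g\<^sub>1 = (t - h) / 3\<close> takes
  values in \<open>{0, t}\<close> and has a third of the boundary of \<open>t\<close>. So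
  \<open>(t - g\<^sub>1) / 2\<close> has the same integral boundary as \<open>g\<^sub>1\<close>, and
  rounding it gives \<open>g\<^sub>2\<close>; with \<open>g\<^sub>3 = t - g\<^sub>1 - g\<^sub>2\<close> this
  splits \<open>t\<close> into three parts with disjoint supports and equal boundaries. If \<open>a, b, c\<close>
  are unit vectors with sum \<open>0\<close>, then
  \<open>g\<^sub>1 a + g\<^sub>2 b + g\<^sub>3 c\<close> has value \<open>\<plusminus>a\<close>, \<open>\<plusminus>b\<close> or
  \<open>\<plusminus>c\<close> on each edge and boundary proportional to \<open>a + b + c = 0\<close>.

  A nowhere-zero 3-flow from a unit vector flow \<open>f\<close>, viewed as complex valued. At most four
  unit complex numbers with sum \<open>0\<close> consist of antipodal pairs or form an
  equilateral triangle. Let \<open>t\<close> be the sign of the half plane containing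
  \<open>f\<^sup>3\<close>: this is odd in \<open>f\<close> and invariant under rotation by a third of a
  turn, so its boundary at a vertex of degree at most four is \<open>0\<close> or
  \<open>\<plusminus>3\<close> (\<open>three_dvd_sum_cube_sign\<close>). Rounding \<open>t / 3\<close> gives
  \<open>g\<close> with values in \<open>{0, t}\<close>, and \<open>t - 3 g\<close> is the required flow.
\<close>

section \<open>Boundaries\<close>

lemma boundary_eq_sum:
  assumes "finite (arcs D)"
  shows "boundary D f v =
    (\<Sum>e\<in>arcs D. (of_bool (tail D e = v) - of_bool (head D e = v)) *\<^sub>R f e)"
proof -
  have "(\<Sum>e\<in>out_arcs D v. f e) = (\<Sum>e\<in>arcs D. of_bool (tail D e = v) *\<^sub>R f e)"
    unfolding out_arcs_def by (rule sum.mono_neutral_cong_left) (use assms in auto)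
  moreover have "(\<Sum>e\<in>in_arcs D v. f e) = (\<Sum>e\<in>arcs D. of_bool (head D e = v) *\<^sub>R f e)"
    unfolding in_arcs_def by (rule sum.mono_neutral_cong_left) (use assms in auto)
  ultimately show ?thesis
    by (simp add: boundary_def scaleR_diff_left sum_subtractf)
qed

lemma boundary_add: "boundary D (\<lambda>e. f e + g e) v = boundary D f v + boundary D g v"
  by (simp add: boundary_def sum.distrib)

lemma boundary_diff: "boundary D (\<lambda>e. f e - g e) v = boundary D f v - boundary D g v"
  by (simp add: boundary_def sum_subtractf)

lemma boundary_linear:
  assumes "linear L"
  shows "boundary D (\<lambda>e. L (f e)) v = L (boundary D f v)"
  by (simp add: boundary_def linear_diff[OF assms] linear_sum[OF assms])

lemma boundary_mult: "boundary D (\<lambda>e. c * f e) v = c * boundary D f v" for c :: real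
  by (simp add: boundary_def sum_distrib_left right_diff_distrib)

lemma boundary_scaleR_const: "boundary D (\<lambda>e. f e *\<^sub>R u) v = boundary D f v *\<^sub>R u"
  by (simp add: boundary_def scaleR_sum_left scaleR_diff_left)

lemma boundary_Ints: "(\<And>e. e \<in> arcs D \<Longrightarrow> f e \<in> \<int>) \<Longrightarrow> boundary D f v \<in> \<int>"
  for f :: "'e \<Rightarrow> real"
  unfolding boundary_def by (intro Ints_diff Ints_sum) auto

lemma boundary_eq_sum_incident:
  fixes D :: "('v, 'e) pre_digraph"
  assumes G: "finite_loopless_graph G" and D: "is_orientation D G"
  shows "boundary D f v = (\<Sum>e\<in>{e \<in> edges G. v \<in> ends G e}. (if tail D e = v then f e else - f e))"
proof -
  have arcs: "arcs D = edges G" and ends: "\<And>e. e \<in> edges G \<Longrightarrow> {tail D e, head D e} = ends G e"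
    using D by (auto simp: is_orientation_def)
  have fin: "finite (arcs D)" using G by (simp add: arcs finite_loopless_graph_def)
  have ne: "tail D e \<noteq> head D e" if "e \<in> edges G" for e
  proof
    assume "tail D e = head D e"
    then have "ends G e = {head D e}" using ends[OF that] by simp
    then show False using G that by (auto simp: finite_loopless_graph_def)
  qed
  show ?thesis
    unfolding boundary_eq_sum[OF fin] arcs
    by (rule sum.mono_neutral_cong_right) (use fin arcs ends ne in \<open>auto simp: ends[symmetric]\<close>)
qed

lemma boundary_outside:
  assumes "finite_loopless_graph G" "is_orientation D G" "v \<notin> vertices G"
  shows "boundary D f v = 0"
proof -
  have "v \<notin> ends G e" if "e \<in> edges G" for e
    using assms(1,3) that by (auto simp: finite_loopless_graph_def)
  then have "{e \<in> edges G. v \<in> ends G e} = {}" by blast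
  then show ?thesis by (simp only: boundary_eq_sum_incident[OF assms(1,2)] sum.empty)
qed

section \<open>Circulations and integral rounding\<close>

text \<open>
  With at least as many arcs as vertices, an undirected cycle exists. Instead of
  constructing it, contract a non-loop arc: both counts drop by one. A
  circulation of the contraction extends to the contracted arc, because the value forced at its
  tail also balances its head, the two boundaries summing to zero. With one vertex left,
  every arc is a loop and carries a circulation by itself.
\<close>

lemma nonzero_circulation:
  fixes D :: "('v, 'e) pre_digraph"
  assumes "finite (arcs D)" "finite V" "V \<noteq> {}" "card V \<le> card (arcs D)"
    and "tail D ` arcs D \<union> head D ` arcs D \<subseteq> V"
  shows "\<exists>k :: 'e \<Rightarrow> real. (\<exists>e\<in>arcs D. k e \<noteq> 0) \<and> (\<forall>v. boundary D k v = 0)"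
  using assms
proof (induction "card V" arbitrary: V D)
  case 0
  then show ?case by simp
next
  case (Suc n)
  have fin: "finite (arcs D)" by fact
  show ?case
  proof (cases "\<exists>e\<in>arcs D. tail D e = head D e")
    case True
    then obtain e where e: "e \<in> arcs D" "tail D e = head D e" by blast
    have "boundary D (\<lambda>x. of_bool (x = e) :: real) v = 0" for v
      unfolding boundary_eq_sum[OF fin] by (rule sum.neutral) (use e in auto)
    then show ?thesis using e by (intro exI[of _ "\<lambda>x. of_bool (x = e)"]) auto
  next
    case False
    have "arcs D \<noteq> {}" using Suc by auto
    then obtain e where e: "e \<in> arcs D" by blast
    define u where "u = tail D e"
    define w where "w = head D e"
    have uw: "u \<noteq> w" "u \<in> V" "w \<in> V" using False e Suc.prems unfolding u_def w_def by auto
    (* D0 deletes the arc e, and D' also merges its head w into its tail u. *)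
    define D0 where "D0 = D\<lparr>arcs := arcs D - {e}\<rparr>"
    define D' where "D' = D0\<lparr>tail := (\<lambda>x. if tail D x = w then u else tail D x),
                             head := (\<lambda>x. if head D x = w then u else head D x)\<rparr>"
    have arcs': "arcs D0 = arcs D - {e}" "arcs D' = arcs D - {e}"
      and fin0: "finite (arcs D0)" and fin': "finite (arcs D')"
      using fin by (simp_all add: D0_def D'_def)
    have "\<exists>k :: 'e \<Rightarrow> real. (\<exists>x\<in>arcs D'. k x \<noteq> 0) \<and> (\<forall>v. boundary D' k v = 0)"
    proof (rule Suc.hyps(1))
      show "n = card (V - {w})" using Suc.hyps(2) uw by simp
      show "finite (arcs D')" by fact
      show "finite (V - {w})" using Suc.prems by simp
      show "V - {w} \<noteq> {}" using uw by auto
      show "card (V - {w}) \<le> card (arcs D')"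
        using Suc.prems fin e uw by (simp add: arcs')
      show "tail D' ` arcs D' \<union> head D' ` arcs D' \<subseteq> V - {w}"
        using Suc.prems(5) uw by (auto simp: D'_def D0_def)
    qed
    then obtain k :: "'e \<Rightarrow> real"
      where k: "\<exists>x\<in>arcs D'. k x \<noteq> 0" "\<And>v. boundary D' k v = 0" by blast
    define k2 where "k2 = k(e := - boundary D0 k u)"
    have split: "boundary D k2 v =
        boundary D0 k v + (of_bool (u = v) - of_bool (w = v)) * k2 e" for v
    proof -
      have "boundary D k2 v = (\<Sum>x\<in>arcs D - {e}. (of_bool (tail D x = v) - of_bool (head D x = v)) * k2 x)
         + (of_bool (u = v) - of_bool (w = v)) * k2 e"
        using fin e by (simp add: boundary_eq_sum sum.remove[of _ e] u_def w_def)
      also have "(\<Sum>x\<in>arcs D - {e}. (of_bool (tail D x = v) - of_bool (head D x = v)) * k2 x)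
         = boundary D0 k v"
        unfolding boundary_eq_sum[OF fin0] arcs' by (rule sum.cong) (auto simp: k2_def D0_def)
      finally show ?thesis .
    qed
    have other: "boundary D0 k v = 0" if "v \<noteq> u" "v \<noteq> w" for v
    proof -
      have "boundary D0 k v = boundary D' k v"
        unfolding boundary_eq_sum[OF fin0] boundary_eq_sum[OF fin'] arcs'
        by (rule sum.cong) (use that in \<open>auto simp: D'_def D0_def\<close>)
      then show ?thesis using k by simp
    qed
    have "boundary D0 k u + boundary D0 k w = boundary D' k u"
      unfolding boundary_eq_sum[OF fin0] boundary_eq_sum[OF fin'] arcs' sum.distrib[symmetric]
      by (rule sum.cong) (use uw in \<open>auto simp: D'_def D0_def\<close>)
    then have merged: "boundary D0 k w = - boundary D0 k u" using k by simp
    have "boundary D k2 v = 0" for v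
      unfolding split using other[of v] merged uw(1) by (cases "v = u"; cases "v = w") (auto simp: k2_def)
    moreover have "\<exists>x\<in>arcs D. k2 x \<noteq> 0" using k(1) by (auto simp: k2_def arcs')
    ultimately show ?thesis by blast
  qed
qed

text \<open>
  A vertex with an integral boundary cannot meet exactly one arc of fractional value. If no
  fractional arc is a loop, double counting therefore shows that there are at least as many
  fractional arcs as vertices on them.
\<close>

lemma fractional_circulation:
  fixes f :: "'e \<Rightarrow> real"
  assumes fin: "finite (arcs D)" and int: "\<And>v. boundary D f v \<in> \<int>"
    and frac: "\<exists>e\<in>arcs D. f e \<notin> \<int>"
  shows "\<exists>k :: 'e \<Rightarrow> real. (\<exists>e\<in>arcs D. k e \<noteq> 0) \<and> (\<forall>e\<in>arcs D. f e \<in> \<int> \<longrightarrow> k e = 0) \<and>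
           (\<forall>v. boundary D k v = 0)"
proof (cases "\<exists>e\<in>arcs D. f e \<notin> \<int> \<and> tail D e = head D e")
  case True
  then obtain e where e: "e \<in> arcs D" "f e \<notin> \<int>" "tail D e = head D e" by blast
  have "boundary D (\<lambda>x. of_bool (x = e) :: real) v = 0" for v
    unfolding boundary_eq_sum[OF fin] by (rule sum.neutral) (use e in auto)
  then show ?thesis using e by (intro exI[of _ "\<lambda>x. of_bool (x = e)"]) auto
next
  case False
  define F where "F = {e \<in> arcs D. f e \<notin> \<int>}"
  define V where "V = tail D ` F \<union> head D ` F"
  have finF: "finite F" and FD: "F \<subseteq> arcs D" and finV: "finite V"
    using fin by (auto simp: F_def V_def)
  define inc where "inc v = {e \<in> F. tail D e = v \<or> head D e = v}" for v
  have two: "2 \<le> card (inc v)" if "v \<in> V" for v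
  proof (rule ccontr)
    assume "\<not> 2 \<le> card (inc v)"
    moreover have "inc v \<noteq> {}" "finite (inc v)" using that finF by (auto simp: V_def inc_def)
    ultimately have "card (inc v) = 1" by (simp add: card_gt_0_iff le_less_Suc_eq not_le
          less_2_cases_iff)
    then obtain e where e: "inc v = {e}" by (auto simp: card_1_singleton_iff)
    then have eF: "e \<in> F" "tail D e = v \<or> head D e = v" by (auto simp: inc_def)
    let ?c = "\<lambda>x. (of_bool (tail D x = v) - of_bool (head D x = v)) * f x"
    have "boundary D f v = ?c e + (\<Sum>x\<in>arcs D - {e}. ?c x)"
      using fin eF FD by (subst boundary_eq_sum) (auto simp: sum.remove[of _ e])
    moreover have "(\<Sum>x\<in>arcs D - {e}. ?c x) \<in> \<int>"
    proof (rule Ints_sum)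
      fix x assume x: "x \<in> arcs D - {e}"
      show "?c x \<in> \<int>"
      proof (cases "x \<in> F")
        case True
        then have "x \<notin> inc v" using x e by auto
        then show ?thesis using True by (auto simp: inc_def)
      next
        case False
        then show ?thesis using x by (auto simp: F_def)
      qed
    qed
    ultimately have "?c e \<in> \<int>" using int[of v] Ints_diff by force
    moreover have "tail D e \<noteq> head D e" "f e \<notin> \<int>" using False eF by (auto simp: F_def)
    ultimately show False using eF(2) by (auto simp: minus_in_Ints_iff)
  qed
  have "2 * card V \<le> (\<Sum>v\<in>V. card (inc v))"
    using sum_mono[of V "\<lambda>_. 2" "\<lambda>v. card (inc v)"] two by simp
  also have "\<dots> = 2 * card F"
    unfolding inc_def
  proof (rule sum_multicount[OF finV finF], intro ballI)
    fix e assume e: "e \<in> F"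
    then have "{v \<in> V. tail D e = v \<or> head D e = v} = {tail D e, head D e}"
      by (auto simp: V_def)
    moreover have "tail D e \<noteq> head D e" using False e by (auto simp: F_def)
    ultimately show "card {v \<in> V. tail D e = v \<or> head D e = v} = 2" by simp
  qed
  finally have "card V \<le> card F" by simp
  moreover have "V \<noteq> {}" using frac by (auto simp: V_def F_def)
  ultimately obtain k :: "'e \<Rightarrow> real" where
    k: "\<exists>e\<in>F. k e \<noteq> 0" "\<And>v. boundary (D\<lparr>arcs := F\<rparr>) k v = 0"
    using nonzero_circulation[of "D\<lparr>arcs := F\<rparr>" V] finF finV by (auto simp: V_def)
  define k' where "k' e = (if e \<in> F then k e else 0)" for e
  have "boundary D k' v = boundary (D\<lparr>arcs := F\<rparr>) k v" for v
    using finF FD fin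
    by (auto simp: boundary_eq_sum k'_def intro!: sum.mono_neutral_cong_right)
  then show ?thesis using k FD by (intro exI[of _ k']) (auto simp: k'_def F_def)
qed

text \<open>
  Adding a multiple of a circulation supported on the fractional arcs keeps the boundary. The
  smallest positive multiple that makes a fractional value integral keeps every value between its
  old floor and ceiling, and it reduces the number of fractional arcs.
\<close>

lemma integral_rounding:
  fixes f :: "'e \<Rightarrow> real"
  assumes fin: "finite (arcs D)" and "\<And>v. boundary D f v \<in> \<int>"
  shows "\<exists>g :: 'e \<Rightarrow> real. (\<forall>e\<in>arcs D. g e \<in> \<int> \<and> \<lfloor>f e\<rfloor> \<le> g e \<and> g e \<le> \<lceil>f e\<rceil>) \<and>
           (\<forall>v. boundary D g v = boundary D f v)"
  using assms(2)
proof (induction "card {e \<in> arcs D. f e \<notin> \<int>}" arbitrary: f rule: less_induct)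
  case less
  show ?case
  proof (cases "\<exists>e\<in>arcs D. f e \<notin> \<int>")
    case False
    then show ?thesis by (intro exI[of _ f]) auto
  next
    case True
    then obtain k :: "'e \<Rightarrow> real" where k: "\<exists>e\<in>arcs D. k e \<noteq> 0"
      "\<forall>e\<in>arcs D. f e \<in> \<int> \<longrightarrow> k e = 0" "\<And>v. boundary D k v = 0"
      using fractional_circulation[OF fin less.prems] by blast
    define S where "S = {e \<in> arcs D. k e \<noteq> 0}"
    (* room e is the multiple of k at which the value on e first becomes an integer. *)
    define room where "room e = (if k e > 0 then \<lceil>f e\<rceil> - f e else f e - \<lfloor>f e\<rfloor>) / \<bar>k e\<bar>" for e
    define m where "m = Min (room ` S)"
    have S: "finite (room ` S)" "room ` S \<noteq> {}" using k fin by (auto simp: S_def)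
    obtain e0 where e0: "e0 \<in> S" "room e0 = m" using Min_in[OF S] by (auto simp: m_def)
    have m_le: "m \<le> room e" if "e \<in> S" for e using that S by (auto simp: m_def)
    have room_nonneg: "0 \<le> room e" for e by (auto simp: room_def)
    have m0: "0 \<le> m" using room_nonneg e0(2) by metis
    define f' where "f' e = f e + m * k e" for e
    have bounds: "\<lfloor>f e\<rfloor> \<le> f' e \<and> f' e \<le> \<lceil>f e\<rceil>" if "e \<in> arcs D" for e
    proof (cases "k e = 0")
      case True
      then show ?thesis by (simp add: f'_def)
    next
      case False
      then have mr: "m \<le> room e" using that m_le by (auto simp: S_def)
      show ?thesis
      proof (cases "k e > 0")
        case True
        then have "m * k e \<le> \<lceil>f e\<rceil> - f e" using mr by (simp add: room_def field_simps)
        moreover have "0 \<le> m * k e" using m0 True by simp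
        moreover have "\<lfloor>f e\<rfloor> \<le> f e" by simp
        ultimately show ?thesis unfolding f'_def by linarith
      next
        case neg: False
        then have "- (m * k e) \<le> f e - \<lfloor>f e\<rfloor>" using mr False by (simp add: room_def field_simps)
        moreover have "m * k e \<le> 0" using m0 neg by (simp add: mult_nonneg_nonpos)
        moreover have "f e \<le> \<lceil>f e\<rceil>" by simp
        ultimately show ?thesis unfolding f'_def by linarith
      qed
    qed
    have e0D: "e0 \<in> arcs D" "k e0 \<noteq> 0" "f e0 \<notin> \<int>" using e0 k by (auto simp: S_def)
    have "f' e0 = (if k e0 > 0 then \<lceil>f e0\<rceil> else \<lfloor>f e0\<rfloor>)"
      unfolding f'_def e0(2)[symmetric] room_def using e0D by (auto simp: field_simps)
    then have "f' e0 \<in> \<int>" by auto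
    moreover have "f' e \<in> \<int>" if "f e \<in> \<int>" "e \<in> arcs D" for e using that k by (auto simp: f'_def)
    ultimately have "{e \<in> arcs D. f' e \<notin> \<int>} \<subset> {e \<in> arcs D. f e \<notin> \<int>}"
      using e0D by blast
    then have "card {e \<in> arcs D. f' e \<notin> \<int>} < card {e \<in> arcs D. f e \<notin> \<int>}"
      using fin by (intro psubset_card_mono) auto
    moreover have bf': "boundary D f' v = boundary D f v" for v
      unfolding f'_def[abs_def] boundary_add boundary_mult using k(3) by simp
    ultimately obtain g :: "'e \<Rightarrow> real" where
      g: "\<forall>e\<in>arcs D. g e \<in> \<int> \<and> \<lfloor>f' e\<rfloor> \<le> g e \<and> g e \<le> \<lceil>f' e\<rceil>"
         "\<forall>v. boundary D g v = boundary D f v"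
      using less.hyps[of f'] less.prems by auto
    have "\<lfloor>f e\<rfloor> \<le> g e \<and> g e \<le> \<lceil>f e\<rceil>" if "e \<in> arcs D" for e
    proof -
      have "\<lfloor>f e\<rfloor> \<le> \<lfloor>f' e\<rfloor>" "\<lceil>f' e\<rceil> \<le> \<lceil>f e\<rceil>"
        using bounds[OF that] by (auto simp: le_floor_iff ceiling_le_iff)
      then show ?thesis using g(1) that by (meson of_int_le_iff order_trans)
    qed
    then show ?thesis using g by blast
  qed
qed

lemma integer_near_fraction_of_sign:
  fixes x t c :: real
  assumes "x \<in> \<int>" "t = 1 \<or> t = -1" "0 < c" "c < 1" "\<lfloor>c * t\<rfloor> \<le> x" "x \<le> \<lceil>c * t\<rceil>"
  shows "x = 0 \<or> x = t"
proof -
  obtain n where n: "x = of_int n" using assms(1) by (auto elim: Ints_cases)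
  then have n': "\<lfloor>c * t\<rfloor> \<le> n" "n \<le> \<lceil>c * t\<rceil>" using assms by auto
  show ?thesis
  proof (cases "t = 1")
    case True
    then have "\<lfloor>c * t\<rfloor> = 0" "\<lceil>c * t\<rceil> = 1"
      using assms by (simp_all add: floor_eq_iff ceiling_eq_iff)
    then have "n = 0 \<or> n = 1" using n' by auto
    then show ?thesis using n True by auto
  next
    case False
    then have "\<lfloor>c * t\<rfloor> = -1" "\<lceil>c * t\<rceil> = 0"
      using assms by (auto simp: floor_eq_iff ceiling_eq_iff)
    then have "n = 0 \<or> n = -1" using n' by auto
    then show ?thesis using n False assms(2) by auto
  qed
qed

section \<open>From nowhere-zero 3-flows to unit vector flows\<close>

lemma unit_triangle:
  "\<exists>a b c :: real ^ 2. norm a = 1 \<and> norm b = 1 \<and> norm c = 1 \<and> a + b + c = 0"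
proof (intro exI conjI)
  show "norm (vector [1, 0] :: real^2) = 1" "norm (vector [-1/2, sqrt 3 / 2] :: real^2) = 1"
    "norm (vector [-1/2, - (sqrt 3 / 2)] :: real^2) = 1"
    by (simp_all add: norm_eq_1 inner_vec_def sum_2)
  show "vector [1, 0] + vector [-1/2, sqrt 3 / 2] + vector [-1/2, - (sqrt 3 / 2)] = (0 :: real^2)"
    by (simp add: vec_eq_iff forall_2)
qed

lemma unit_flow_of_3_flow:
  assumes "finite_loopless_graph G" and "admits_nowhere_zero_3_flow G"
  shows "admits_S1_flow G"
proof -
  obtain D and h :: "'b \<Rightarrow> real" where D: "is_orientation D G"
    and h: "\<And>e. e \<in> edges G \<Longrightarrow> h e \<in> {1, -1, 2, -2}"
    and bh: "\<And>v. v \<in> vertices G \<Longrightarrow> boundary D h v = 0"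
    using assms(2) unfolding admits_nowhere_zero_3_flow_def admits_flow_def is_flow_def by blast
  have arcs: "arcs D = edges G" using D by (simp add: is_orientation_def)
  have fin: "finite (arcs D)" using assms(1) by (simp add: arcs finite_loopless_graph_def)
  (* The sign congruent to h modulo 3. *)
  define t where "t e = (if h e = 1 \<or> h e = -2 then 1 else -1 :: real)" for e
  define g1 where "g1 e = (t e - h e) / 3" for e
  have g1: "g1 e = 0 \<or> g1 e = t e" if "e \<in> arcs D" for e
    using h[of e] that by (auto simp: g1_def t_def arcs)
  have t: "t e = 1 \<or> t e = -1" for e by (simp add: t_def)
  define r where "r e = 1/2 * (t e - g1 e)" for e
  have bg1: "boundary D g1 v = boundary D t v / 3" if "v \<in> vertices G" for v
    using bh[OF that] boundary_mult[of D "1/3" "\<lambda>e. t e - h e" v]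
    by (simp add: g1_def[abs_def] boundary_diff)
  have br: "boundary D r v = (boundary D t v - boundary D g1 v) / 2" for v
    unfolding r_def[abs_def] boundary_mult boundary_diff by simp
  have brg: "boundary D r v = boundary D g1 v" if "v \<in> vertices G" for v
    using bg1[OF that] by (simp add: br)
  have "boundary D r v \<in> \<int>" for v
  proof (cases "v \<in> vertices G")
    case True
    have "g1 e \<in> \<int>" if "e \<in> arcs D" for e using g1[OF that] t[of e] by auto
    then show ?thesis using brg[OF True] boundary_Ints by metis
  next
    case False
    then show ?thesis using boundary_outside[OF assms(1) D, of v r] by simp
  qed
  from integral_rounding[OF fin this] obtain g2 :: "'b \<Rightarrow> real" where
    g2: "\<And>e. e \<in> arcs D \<Longrightarrow> g2 e \<in> \<int> \<and> \<lfloor>r e\<rfloor> \<le> g2 e \<and> g2 e \<le> \<lceil>r e\<rceil>"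
    and bg2: "\<And>v. boundary D g2 v = boundary D r v" by blast
  have g2': "g2 e = 0 \<or> g2 e = t e - g1 e" if e: "e \<in> arcs D" for e
  proof -
    consider "g1 e = t e" | "g1 e = 0" using g1[OF e] by blast
    then show ?thesis
    proof cases
      case 1
      then show ?thesis using g2[OF e] by (simp add: r_def)
    next
      case 2
      then show ?thesis
        using integer_near_fraction_of_sign[of "g2 e" "t e" "1/2"] g2[OF e] t[of e] by (simp add: r_def)
    qed
  qed
  obtain a b c :: "real ^ 2" where abc: "norm a = 1" "norm b = 1" "norm c = 1" "a + b + c = 0"
    using unit_triangle by blast
  define f where "f e = g1 e *\<^sub>R a + g2 e *\<^sub>R b + (t e - g1 e - g2 e) *\<^sub>R c" for e
  have "norm (f e) = 1" if "e \<in> arcs D" for e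
    using g1[OF that] g2'[OF that] t[of e] abc by (auto simp: f_def)
  moreover have "boundary D f v = 0" if v: "v \<in> vertices G" for v
  proof -
    have "boundary D (\<lambda>e. t e - g1 e - g2 e) v = boundary D g1 v"
      using bg1[OF v] brg[OF v] bg2[of v] by (simp add: boundary_diff)
    then have "boundary D f v = boundary D g1 v *\<^sub>R (a + b + c)"
      using bg2[of v] brg[OF v]
      by (simp add: f_def[abs_def] boundary_add boundary_scaleR_const scaleR_add_right)
    then show ?thesis using abc by simp
  qed
  ultimately have "is_flow {x :: real ^ 2. norm x = 1} G D f"
    using D by (auto simp: is_flow_def arcs)
  then show ?thesis unfolding admits_S1_flow_def admits_flow_def by blast
qed

section \<open>Vanishing sums of at most four unit complex numbers\<close>

text \<open>
  The boundary line is split between the two signs so that the sign is odd on all nonzero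
  numbers.
\<close>

definition half_plane_sign :: "complex \<Rightarrow> int" where
  "half_plane_sign z = (if Re z > 0 \<or> Re z = 0 \<and> Im z > 0 then 1 else -1)"

lemma half_plane_sign_minus: "z \<noteq> 0 \<Longrightarrow> half_plane_sign (- z) = - half_plane_sign z"
  by (auto simp: half_plane_sign_def complex_eq_iff)

text \<open>
  Cubing is odd and forgets factors that are third roots of unity. Hence this sign changes
  under \<open>z \<mapsto> - z\<close> and is constant on the three numbers
  of any equilateral triangle centred at \<open>0\<close>.
\<close>

definition cube_sign :: "complex \<Rightarrow> int" where
  "cube_sign z = half_plane_sign (z ^ 3)"

lemma cube_sign_cases: "cube_sign z = 1 \<or> cube_sign z = -1"
  by (simp add: cube_sign_def half_plane_sign_def)

lemma cube_sign_minus: "z \<noteq> 0 \<Longrightarrow> cube_sign (- z) = - cube_sign z"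
  by (simp add: cube_sign_def half_plane_sign_minus)

lemma cnj_unit: "cmod z = 1 \<Longrightarrow> cnj z = 1 / z"
  using complex_div_cnj[of 1 z] by simp

text \<open>
  Conjugating \<open>a + b + c = 0\<close> inverts each summand, so the second elementary symmetric
  polynomial of \<open>a, b, c\<close> vanishes as well as the first: the three numbers are the
  roots of \<open>X\<^sup>3 - a b c\<close>.
\<close>

lemma unit_triple_cubes_eq:
  fixes a b c :: complex
  assumes "cmod a = 1" "cmod b = 1" "cmod c = 1" "a + b + c = 0"
  shows "a ^ 3 = b ^ 3"
proof -
  have nz: "a \<noteq> 0" "b \<noteq> 0" "c \<noteq> 0" using assms by auto
  have "cnj a + cnj b + cnj c = cnj (a + b + c)" by simp
  also have "\<dots> = 0" unfolding assms(4) by simp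
  finally have "1 / a + 1 / b + 1 / c = 0" using assms(1-3) by (simp add: cnj_unit)
  then have "b * c + a * c + a * b = 0" using nz by (simp add: field_simps)
  moreover have "c = - a - b" using assms(4) by (simp add: algebra_simps eq_neg_iff_add_eq_0)
  ultimately have "a\<^sup>2 + a * b + b\<^sup>2 = 0" by algebra
  then show ?thesis by algebra
qed

text \<open>
  As for triples, conjugation shows that the third elementary symmetric polynomial
  vanishes with the first, and
  \<open>(a + b) (a + c) (a + d) = a\<^sup>2 (a + b + c + d) + (b c d + a c d + a b d + a b c)\<close>.
\<close>

lemma unit_quadruple_antipodal:
  fixes a b c d :: complex
  assumes "cmod a = 1" "cmod b = 1" "cmod c = 1" "cmod d = 1" and s: "a + b + c + d = 0"
  shows "b = - a \<and> d = - c \<or> c = - a \<and> d = - b \<or> d = - a \<and> c = - b"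
proof -
  have nz: "a \<noteq> 0" "b \<noteq> 0" "c \<noteq> 0" "d \<noteq> 0" using assms by auto
  have "cnj a + cnj b + cnj c + cnj d = cnj (a + b + c + d)" by simp
  also have "\<dots> = 0" unfolding s by simp
  finally have "1 / a + 1 / b + 1 / c + 1 / d = 0" using assms(1-4) by (simp add: cnj_unit)
  then have "(1 / a + 1 / b + 1 / c + 1 / d) * (a * b * c * d) = 0" by simp
  then have "b * c * d + a * c * d + a * b * d + a * b * c = 0"
    using nz by (simp add: algebra_simps)
  then have "(a + b) * (a + c) * (a + d) = 0" using s by algebra
  then consider "a + b = 0" | "a + c = 0" | "a + d = 0" by auto
  then show ?thesis
  proof cases
    case 1
    then have "c + d = 0" using s by (simp add: add.assoc)
    then show ?thesis using 1 by (simp add: add_eq_0_iff)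
  next
    case 2
    then have "b + d = 0" using s by algebra
    then show ?thesis using 2 by (simp add: add_eq_0_iff)
  next
    case 3
    then have "b + c = 0" using s by algebra
    then show ?thesis using 3 by (simp add: add_eq_0_iff)
  qed
qed

text \<open>
  A single unit number is not zero, two cancel only if antipodal, three only if
  their cubes agree, and four only in antipodal pairs. Antipodal pairs contribute \<open>0\<close>
  to the sum of signs and a triple contributes \<open>3\<close> or \<open>-3\<close>. Five
  unit numbers have no such rigidity, which is where the degree bound enters.
\<close>

lemma three_dvd_sum_cube_sign:
  fixes a :: "'e \<Rightarrow> complex"
  assumes "finite I" "card I \<le> 4" and unit: "\<And>e. e \<in> I \<Longrightarrow> cmod (a e) = 1"
    and sum0: "(\<Sum>e\<in>I. a e) = 0"
  shows "3 dvd (\<Sum>e\<in>I. cube_sign (a e))"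
proof -
  have nz: "a e \<noteq> 0" if "e \<in> I" for e using unit[OF that] by auto
  consider "card I = 0" | "card I = 1" | "card I = 2" | "card I = 3" | "card I = 4"
    using assms(2) by linarith
  then show ?thesis
  proof cases
    case 1
    then show ?thesis using assms(1) by simp
  next
    case 2
    then obtain x where "I = {x}" by (auto simp: card_1_singleton_iff)
    then show ?thesis using sum0 nz by simp
  next
    case 3
    then obtain x y where I: "I = {x, y}" "x \<noteq> y" by (auto simp: card_2_iff)
    then have "a y = - a x" using sum0 by (simp add: add_eq_0_iff)
    then show ?thesis using I nz by (simp add: cube_sign_minus)
  next
    case 4
    then obtain x y z where I: "I = {x, y, z}" "x \<noteq> y" "x \<noteq> z" "y \<noteq> z"
      by (auto simp: card_3_iff)
    have s: "a x + a y + a z = 0" "a x + a z + a y = 0" using sum0 I by (simp_all add: algebra_simps)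
    have "a x ^ 3 = a y ^ 3" "a x ^ 3 = a z ^ 3"
      using I unit unit_triple_cubes_eq[OF _ _ _ s(1)] unit_triple_cubes_eq[OF _ _ _ s(2)] by auto
    then have "cube_sign (a x) = cube_sign (a y)" "cube_sign (a x) = cube_sign (a z)"
      by (simp_all add: cube_sign_def)
    then show ?thesis using I by simp
  next
    case 5
    then obtain x J where J: "I = insert x J" "x \<notin> J" "card J = 3"
      by (metis card_Suc_eq numeral_eq_Suc pred_numeral_simps(2) pred_numeral_simps(3) semiring_norm(26,27))
    then obtain y z w where "J = {y, z, w}" "y \<noteq> z" "y \<noteq> w" "z \<noteq> w"
      by (auto simp: card_3_iff)
    then have I: "I = {x, y, z, w}" "distinct [x, y, z, w]" using J by auto
    have "a x + a y + a z + a w = 0" using sum0 I by (simp add: algebra_simps)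
    from unit_quadruple_antipodal[OF _ _ _ _ this] have
      "a y = - a x \<and> a w = - a z \<or> a z = - a x \<and> a w = - a y \<or> a w = - a x \<and> a z = - a y"
      using unit I by simp
    then show ?thesis using I nz by (auto simp: cube_sign_minus)
  qed
qed

section \<open>From unit vector flows to nowhere-zero 3-flows\<close>

lemma degree_le_max_degree:
  assumes "finite (vertices G)" "v \<in> vertices G"
  shows "degree G v \<le> max_degree G"
  unfolding max_degree_def using assms by (intro cSUP_upper) auto

lemma three_flow_of_unit_flow:
  assumes G: "finite_loopless_graph G" and deg: "max_degree G \<le> 4" and S1: "admits_S1_flow G"
  shows "admits_nowhere_zero_3_flow G"
proof -
  obtain D and f0 :: "'b \<Rightarrow> real ^ 2" where D: "is_orientation D G"
    and f0: "\<And>e. e \<in> edges G \<Longrightarrow> norm (f0 e) = 1"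
    and bf0: "\<And>v. v \<in> vertices G \<Longrightarrow> boundary D f0 v = 0"
    using S1 unfolding admits_S1_flow_def admits_flow_def is_flow_def by blast
  have arcs: "arcs D = edges G" using D by (simp add: is_orientation_def)
  have fin: "finite (arcs D)" using G by (simp add: arcs finite_loopless_graph_def)
  define L where "L x = Complex (x $ 1) (x $ 2)" for x :: "real ^ 2"
  have linL: "linear L" by (rule linearI) (simp_all add: L_def complex_eq_iff)
  have normL: "cmod (L x) = norm x" for x
    by (simp add: L_def cmod_def norm_vec_def L2_set_def sum_2)
  define f where "f e = L (f0 e)" for e
  have f: "cmod (f e) = 1" if "e \<in> edges G" for e using f0[OF that] by (simp add: f_def normL)
  have bf: "boundary D f v = 0" if "v \<in> vertices G" for v
    using boundary_linear[OF linL, of D f0 v] bf0[OF that] linear_0[OF linL]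
    by (simp add: f_def[abs_def])
  define t where "t e = real_of_int (cube_sign (f e))" for e
  define r where "r e = 1/3 * t e" for e
  have "boundary D r v \<in> \<int>" for v
  proof (cases "v \<in> vertices G")
    case True
    define I where "I = {e \<in> edges G. v \<in> ends G e}"
    define a where "a e = (if tail D e = v then f e else - f e)" for e
    have "card I \<le> 4"
      using degree_le_max_degree[of G v] True G deg
      by (simp add: I_def degree_def finite_loopless_graph_def)
    moreover have finI: "finite I" using fin by (simp add: I_def arcs)
    moreover have "(\<Sum>e\<in>I. a e) = 0"
      using bf[OF True] by (simp add: boundary_eq_sum_incident[OF G D] I_def a_def)
    moreover have "cmod (a e) = 1" if "e \<in> I" for e using f that by (simp add: a_def I_def)
    ultimately have "3 dvd (\<Sum>e\<in>I. cube_sign (a e))" by (intro three_dvd_sum_cube_sign) auto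
    then obtain q where q: "(\<Sum>e\<in>I. cube_sign (a e)) = 3 * q" by blast
    have "boundary D t v = (\<Sum>e\<in>I. real_of_int (cube_sign (a e)))"
      unfolding boundary_eq_sum_incident[OF G D] I_def[symmetric]
    proof (rule sum.cong[OF refl])
      fix e assume "e \<in> I"
      then have "f e \<noteq> 0" using f[of e] by (auto simp: I_def)
      then show "(if tail D e = v then t e else - t e) = real_of_int (cube_sign (a e))"
        by (simp add: t_def a_def cube_sign_minus)
    qed
    also have "\<dots> = 3 * of_int q" using q by (metis of_int_mult of_int_numeral of_int_sum)
    finally have "boundary D r v = of_int q" unfolding r_def[abs_def] boundary_mult by simp
    then show ?thesis by simp
  next
    case False
    then show ?thesis using boundary_outside[OF G D, of v r] by simp
  qed
  from integral_rounding[OF fin this] obtain g :: "'b \<Rightarrow> real" where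
    g: "\<And>e. e \<in> arcs D \<Longrightarrow> g e \<in> \<int> \<and> \<lfloor>r e\<rfloor> \<le> g e \<and> g e \<le> \<lceil>r e\<rceil>"
    and bg: "\<And>v. boundary D g v = boundary D r v" by blast
  define h where "h e = t e - 3 * g e" for e
  have "h e \<in> {1, -1, 2, -2}" if e: "e \<in> arcs D" for e
  proof -
    have t: "t e = 1 \<or> t e = -1" using cube_sign_cases[of "f e"] by (auto simp: t_def)
    then have "g e = 0 \<or> g e = t e"
      using integer_near_fraction_of_sign[of "g e" "t e" "1/3"] g[OF e] by (simp add: r_def)
    then show ?thesis using t by (auto simp: h_def)
  qed
  moreover have "boundary D h v = 0" for v
    unfolding h_def[abs_def] boundary_diff boundary_mult bg r_def[abs_def] by simp
  ultimately have "is_flow {1, -1, 2, -2} G D h"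
    using D by (auto simp: is_flow_def arcs)
  then show ?thesis unfolding admits_nowhere_zero_3_flow_def admits_flow_def by blast
qed

theorem theorem1p5:
  fixes G :: "('v, 'e) multigraph"
  assumes "finite_loopless_graph G"
    and "max_degree G \<le> 4"
  shows "admits_nowhere_zero_3_flow G \<longleftrightarrow> admits_S1_flow G"
  using unit_flow_of_3_flow three_flow_of_unit_flow assms by blast

end
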